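(* Let $s\geq 5$ be an integer and $W$ a squarefree positive integer. Assume $\gcd(2\cdot3\cdot5,W)=1$ if $s\geq 6$, and $\gcd(2\cdot 3\cdot 5\cdot 7,W)=1$ if $s=5$. Let $f_j:(\mathbb{Z}/W)^{\times(2)}\to[0,1]$, $1\leq j\leq s$, be functions with \[ \frac{1}{s}\big(\mathbb{E}[f_1]+\dots+\mathbb{E}[f_s]\big)>d_s \quad\text{and}\quad \mathbb{E}[f_j]\neq 0 \text{ for all } 1\leq j\leq s. \] Then for every $y\in\mathbb{Z}/W$ there exist $x_1,\dots,x_s\in(\mathbb{Z}/W)^{\times(2)}$ with $y=x_1+\dots+x_s$ such that \[ \frac{1}{s}\big(f_1(x_1)+\dots+f_s(x_s)\big)>d_s \quad\text{and}\quad f_j(x_j)\neq 0 \text{ for all } 1\leq j\leq s. \]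
   Context: $(\mathbb{Z}/W)^{\times(2)}=\{x\in\mathbb{Z}/W: x=y^2\text{ for some } y\in(\mathbb{Z}/W)^{\times}\}$. $\mathbb{E}[f]$ denotes the average of $f$ over its (finite) domain. For integers $s\geq 5$: $d_s=9/10$ if $s=5$; $d_s=5/6$ if $s=6$; $d_s=(s+13)/(4s)$ if $7\leq s\leq 12$; $d_s=1/2$ if $s\geq 13$. *)

theory Defs
  imports
    Complex_Main
    "HOL-Algebra.IntRing"
    "HOL-Computational_Algebra.Squarefree"
begin

text \<open>The ring of integers modulo \<open>W\<close> is the quotient ring \<open>ZFact (int W)\<close>. Unlike
  \<open>residue_ring (int W)\<close>, whose unit element is the integer \<open>1\<close> also when \<open>W = 1\<close>, it is the
  correct (zero) ring in that case. Its elements are cosets, i.e. sets of integers.\<close>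

definition unit_squares :: "nat \<Rightarrow> int set set" where
  "unit_squares W = {x \<in> carrier (ZFact (int W)).
     \<exists>y \<in> Units (ZFact (int W)). x = y [^]\<^bsub>ZFact (int W)\<^esub> (2::nat)}"

definition average :: "'a set \<Rightarrow> ('a \<Rightarrow> real) \<Rightarrow> real" where
  "average S f = (\<Sum>x\<in>S. f x) / real (card S)"

text \<open>The threshold is meant for \<open>s \<ge> 5\<close> only; smaller \<open>s\<close> get a dummy value.\<close>

definition threshold :: "nat \<Rightarrow> real" where
  "threshold s =
     (if s = 5 then 9 / 10
      else if s = 6 then 5 / 6
      else if 7 \<le> s \<and> s \<le> 12 then (real s + 13) / (4 * real s)
      else 1 / 2)"

end

theory Submission
  imports Defs "HOL-Number_Theory.Cong" "HOL-Computational_Algebra.Primes"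
begin

text \<open>
  Averaging \<open>f\<^sub>j\<close> over the fibres of \<open>\<int>/pm \<rightarrow> \<int>/p\<close> reduces the claim to prime moduli. For a prime \<open>p\<close>
  list the values of \<open>f\<^sub>j\<close> on the \<open>n = (p - 1)/2\<close> squares in decreasing order
  \<open>a\<^sub>j(0) \<ge> \<dots> \<ge> a\<^sub>j(n - 1)\<close>. If \<open>\<Sum> k\<^sub>j \<ge> 2n\<close>, then by Cauchy--Davenport every residue is a sum of elements
  taken from the top \<open>k\<^sub>j + 1\<close> of the \<open>j\<close>-th list, so one has to find positions \<open>k\<^sub>j\<close> with
  \<open>\<Sum> k\<^sub>j \<ge> 2n\<close>, \<open>a\<^sub>j(k\<^sub>j) > 0\<close> and \<open>\<Sum> a\<^sub>j(k\<^sub>j)\<close> above the threshold.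

  Such positions come from couplings: if \<open>\<pi>\<^sub>j\<close> are permutations of \<open>{0, \<dots>, n - 1}\<close>, then for some \<open>u\<close> the
  positions \<open>\<pi>\<^sub>j(u)\<close>, truncated to the support of \<open>a\<^sub>j\<close>, have total value at least the sum \<open>T\<close> of the
  means. For \<open>s = 5\<close> the total loss is below \<open>1/2\<close>, so positivity is automatic and no truncation is needed.
  For \<open>s \<ge> 6\<close> one has \<open>T > 5\<close>. Let \<open>b\<^sub>j\<close> be the last position in the support of \<open>a\<^sub>j\<close>. Choosing
  \<open>k\<^sub>j = b\<^sub>j\<close> works unless \<open>\<Sum> b\<^sub>j > (n - 1) T\<close>; otherwise the indices are split into two groups with
  nearly equal sums of \<open>b\<^sub>j\<close>, one group using \<open>u\<close> and the other \<open>n - 1 - u\<close>.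
\<close>

section \<open>Sums of sets of residues\<close>

definition sumset_mod :: "int \<Rightarrow> int set \<Rightarrow> int set \<Rightarrow> int set" where
  "sumset_mod p A B = (\<lambda>(a, b). (a + b) mod p) ` (A \<times> B)"

lemma inj_on_shift_mod:
  fixes p :: int
  assumes "A \<subseteq> {0..<p}"
  shows "inj_on (\<lambda>a. (a + e) mod p) A"
proof (rule inj_onI)
  fix x y assume xy: "x \<in> A" "y \<in> A" "(x + e) mod p = (y + e) mod p"
  then have "[x = y] (mod p)" by (metis cong_add_rcancel cong_def)
  moreover have "x \<in> {0..<p}" "y \<in> {0..<p}" using xy assms by auto
  ultimately show "x = y" by (auto intro: cong_less_imp_eq_int)
qed

text \<open>A set closed under adding \<open>d\<close> contains the whole orbit of each of its
  points, and modulo a prime \<open>p\<close> not dividing \<open>d\<close> every orbit is all of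
  \<open>{0..<p}\<close>.\<close>

lemma shift_escapes:
  fixes p d :: int
  assumes p: "prime p" and A: "A \<subseteq> {0..<p}" "A \<noteq> {}" "A \<noteq> {0..<p}" and d: "\<not> p dvd d"
  obtains a where "a \<in> A" "(a + d) mod p \<notin> A"
proof -
  have "\<exists>a\<in>A. (a + d) mod p \<notin> A"
  proof (rule ccontr)
    assume "\<not> ?thesis"
    then have closed: "(a + d) mod p \<in> A" if "a \<in> A" for a using that by blast
    obtain a where a: "a \<in> A" using A by auto
    have multiples: "(a + int k * d) mod p \<in> A" for k
    proof (induction k)
      case 0
      then show ?case using a A by (auto simp: subset_eq)
    next
      case (Suc k)
      have "((a + int k * d) mod p + d) mod p = (a + int (Suc k) * d) mod p"
        by (simp add: mod_simps algebra_simps)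
      then show ?case using closed[OF Suc] by simp
    qed
    have "coprime d p" using prime_imp_coprime[OF p d] by (simp add: coprime_commute)
    have "y \<in> A" if y: "y \<in> {0..<p}" for y
    proof -
      \<comment> \<open>\<open>x\<close> counts the steps of length \<open>d\<close> from
        \<open>a\<close> to \<open>y\<close>; its residue modulo \<open>p\<close> serves as a
        natural number of steps.\<close>
      obtain x where x: "[d * x = y - a] (mod p)"
        using cong_solve_coprime_int[OF \<open>coprime d p\<close>] cong_scalar_right[of "d * _" 1 p "y - a"]
        by (metis mult.assoc mult_1)
      have "[int (nat (x mod p)) = x] (mod p)"
        using prime_gt_0_int[OF p] by (simp add: cong_def)
      then have "[a + int (nat (x mod p)) * d = a + d * x] (mod p)"
        unfolding mult.commute[of d x] by (intro cong_add cong_refl cong_scalar_right)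
      also have "[a + d * x = a + (y - a)] (mod p)" by (intro cong_add x cong_refl)
      finally have "(a + int (nat (x mod p)) * d) mod p = y" using y by (simp add: cong_def)
      then show ?thesis using multiples by metis
    qed
    then show False using A by auto
  qed
  then show ?thesis using that by blast
qed

text \<open>Induction on \<open>card B\<close> with the Dyson transform \<open>(A, B) \<mapsto> (A \<union> (B + e), B \<inter> (A - e))\<close>, where
  \<open>e\<close> is chosen such that the second set becomes smaller but not empty.\<close>

lemma cauchy_davenport:
  fixes p :: int
  assumes p: "prime p" and "A \<subseteq> {0..<p}" "B \<subseteq> {0..<p}" "A \<noteq> {}" "B \<noteq> {}"
  shows "min (nat p) (card A + card B - 1) \<le> card (sumset_mod p A B)"
  using assms(2-)
proof (induction "card B" arbitrary: A B rule: less_induct)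
  case less
  have fin: "finite A" "finite B" using less.prems finite_subset by blast+
  have fin_sum: "finite (sumset_mod p A' B')" if "finite A'" "finite B'" for A' B'
    using that by (simp add: sumset_mod_def)
  \<comment> \<open>One translate of \<open>A\<close> inside the sumset already settles the cases in
    which \<open>B\<close> is a singleton or \<open>A\<close> is everything.\<close>
  have shift: "card A \<le> card (sumset_mod p A B)" if "b \<in> B" for b
  proof -
    have "card A = card ((\<lambda>a. (a + b) mod p) ` A)"
      using card_image[OF inj_on_shift_mod[OF less.prems(1)]] by simp
    also have "\<dots> \<le> card (sumset_mod p A B)"
      using that fin by (intro card_mono fin_sum) (auto simp: sumset_mod_def)
    finally show ?thesis .
  qed
  obtain b1 where b1: "b1 \<in> B" using less.prems by auto
  show ?case
  proof (cases "B = {b1} \<or> A = {0..<p}")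
    case True
    then show ?thesis using shift[OF b1] by auto
  next
    case False
    then obtain b2 where b2: "b2 \<in> B" "b2 \<noteq> b1" using b1 by blast
    have range: "b1 \<in> {0..<p}" "b2 \<in> {0..<p}" using b1 b2 less.prems by auto
    have "\<not> p dvd b2 - b1"
    proof
      assume "p dvd b2 - b1"
      then have "[b2 = b1] (mod p)" by (simp add: cong_iff_dvd_diff)
      then show False using b2 range by (auto dest: cong_less_imp_eq_int)
    qed
    then obtain a where a: "a \<in> A" "(a + (b2 - b1)) mod p \<notin> A"
      using shift_escapes[OF p less.prems(1,3)] False by blast
    \<comment> \<open>This shift moves \<open>b1\<close> to \<open>a \<in> A\<close> and
      \<open>b2\<close> outside \<open>A\<close>, so \<open>B'\<close> keeps \<open>b1\<close> and
      loses \<open>b2\<close>.\<close>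
    define e where "e = a - b1"
    define E where "E = (\<lambda>b. (b + e) mod p) ` B"
    define A' where "A' = A \<union> E"
    define B' where "B' = {b \<in> B. (b + e) mod p \<in> A}"
    have "b1 \<in> B'" using b1 a less.prems(1) by (auto simp: B'_def e_def subset_eq)
    have "b2 \<notin> B'" using a by (auto simp: B'_def e_def algebra_simps)
    then have B': "B' \<subset> B" using b2 by (auto simp: B'_def)
    have "p > 0" using p prime_gt_0_int by blast
    then have A': "A' \<subseteq> {0..<p}" using less.prems(1) by (auto simp: A'_def E_def)
    have "A \<inter> E = (\<lambda>b. (b + e) mod p) ` B'" by (auto simp: E_def B'_def)
    moreover have "B' \<subseteq> {0..<p}" using B' less.prems(2) by blast
    ultimately have "card (A \<inter> E) = card B'" using card_image[OF inj_on_shift_mod] by metis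
    moreover have "card E = card B"
      unfolding E_def by (rule card_image[OF inj_on_shift_mod[OF less.prems(2)]])
    ultimately have "card A' + card B' = card A + card B"
      using card_Un_Int[of A E] fin by (simp add: A'_def E_def)
    moreover have "min (nat p) (card A' + card B' - 1) \<le> card (sumset_mod p A' B')"
      using \<open>b1 \<in> B'\<close> A' B' less.prems \<open>B' \<subseteq> {0..<p}\<close>
      by (intro less.hyps psubset_card_mono fin) (auto simp: A'_def)
    moreover have "sumset_mod p A' B' \<subseteq> sumset_mod p A B"
    proof
      fix z assume "z \<in> sumset_mod p A' B'"
      then obtain x b where z: "z = (x + b) mod p" "x \<in> A'" "b \<in> B'"
        by (auto simp: sumset_mod_def)
      show "z \<in> sumset_mod p A B"
      proof (cases "x \<in> A")
        case True
        then show ?thesis using z B' by (auto simp: sumset_mod_def)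
      next
        case False
        then obtain c where c: "c \<in> B" "x = (c + e) mod p" using z by (auto simp: A'_def E_def)
        \<comment> \<open>Regrouping \<open>(c + e) + b\<close> as \<open>(b + e) + c\<close> gives
          a first summand in \<open>A\<close>, because \<open>b\<close> lies in
          \<open>B'\<close>.\<close>
        have "z = (case ((b + e) mod p, c) of (v, w) \<Rightarrow> (v + w) mod p)"
          unfolding z c(2) by (simp add: mod_simps algebra_simps)
        moreover have "((b + e) mod p, c) \<in> A \<times> B" using z c by (simp add: B'_def)
        ultimately show ?thesis unfolding sumset_mod_def by (rule image_eqI)
      qed
    qed
    then have "card (sumset_mod p A' B') \<le> card (sumset_mod p A B)"
      by (intro card_mono fin_sum fin)
    ultimately show ?thesis by linarith
  qed
qed

text \<open>The sets are added one by one, and each raises the lower bound by its cardinality minus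
  1; the leading 1 is the empty sum \<open>{0}\<close>. Once the bound reaches \<open>p\<close>,
  every residue is attained.\<close>

lemma cauchy_davenport_family:
  fixes p :: int
  assumes p: "prime p" and J: "finite J"
    and A: "\<And>j. j \<in> J \<Longrightarrow> A j \<subseteq> {0..<p}" "\<And>j. j \<in> J \<Longrightarrow> A j \<noteq> {}"
    and large: "nat p \<le> 1 + (\<Sum>j\<in>J. card (A j) - 1)"
  obtains x where "\<And>j. j \<in> J \<Longrightarrow> x j \<in> A j" "(\<Sum>j\<in>J. x j) mod p = y mod p"
proof -
  define S where "S I = {(\<Sum>j\<in>I. x j) mod p | x. \<forall>j\<in>I. x j \<in> A j}" for I
  have p0: "p > 0" using p prime_gt_0_int by blast
  have S: "S I \<subseteq> {0..<p}" for I using p0 by (auto simp: S_def)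
  have "min (nat p) (1 + (\<Sum>j\<in>J. card (A j) - 1)) \<le> card (S J) \<and> S J \<noteq> {}"
    using J A
  proof (induction J rule: finite_induct)
    case empty
    then show ?case by (simp add: S_def)
  next
    case (insert i I)
    have IH: "min (nat p) (1 + (\<Sum>j\<in>I. card (A j) - 1)) \<le> card (S I)" "S I \<noteq> {}"
      using insert by auto
    have "sumset_mod p (S I) (A i) \<subseteq> S (insert i I)"
    proof
      fix z assume "z \<in> sumset_mod p (S I) (A i)"
      then obtain x b where x: "\<forall>j\<in>I. x j \<in> A j" "b \<in> A i" "z = ((\<Sum>j\<in>I. x j) mod p + b) mod p"
        by (auto simp: sumset_mod_def S_def)
      have "(\<Sum>j\<in>I. (x(i := b)) j) = (\<Sum>j\<in>I. x j)"
        using insert.hyps by (intro sum.cong) auto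
      then have "z = (\<Sum>j\<in>insert i I. (x(i := b)) j) mod p"
        using insert.hyps x by (simp add: mod_simps add.commute)
      moreover have "\<forall>j\<in>insert i I. (x(i := b)) j \<in> A j" using x by auto
      ultimately show "z \<in> S (insert i I)" unfolding S_def by blast
    qed
    then have "card (sumset_mod p (S I) (A i)) \<le> card (S (insert i I))"
      by (intro card_mono) (meson S finite_atLeastLessThan_int finite_subset)
    moreover have "min (nat p) (card (S I) + card (A i) - 1) \<le> card (sumset_mod p (S I) (A i))"
      using insert.prems IH S by (intro cauchy_davenport p) auto
    moreover have "card (A i) \<ge> 1" "nat p > 0"
      using insert.prems p0 finite_subset[OF insert.prems(1)[of i]] by (auto simp: Suc_le_eq card_gt_0_iff)
    ultimately have "min (nat p) (1 + (\<Sum>j\<in>insert i I. card (A j) - 1)) \<le> card (S (insert i I))"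
      using insert.hyps IH(1) by auto
    moreover from this have "card (S (insert i I)) > 0" using \<open>nat p > 0\<close> by linarith
    ultimately show ?case by auto
  qed
  then have "card {0..<p} \<le> card (S J)" using large by auto
  then have "S J = {0..<p}" by (intro card_seteq S) auto
  then have "y mod p \<in> S J" using p0 by simp
  then show ?thesis using that unfolding S_def by force
qed

section \<open>Choosing positions in decreasing families\<close>

text \<open>Greedy balancing: each new index joins the lighter part, and the two parts exchange
  roles if that part becomes the heavier one. The difference thus never exceeds one maximal
  weight.\<close>

lemma balanced_partition:
  fixes b :: "'j \<Rightarrow> nat"
  assumes "finite J" and "\<And>j. j \<in> J \<Longrightarrow> b j \<le> M"
  obtains A B where "A \<union> B = J" "A \<inter> B = {}" "sum b B \<le> sum b A" "sum b A \<le> sum b B + M"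
proof -
  have "\<exists>A B. A \<union> B = J \<and> A \<inter> B = {} \<and> sum b B \<le> sum b A \<and> sum b A \<le> sum b B + M"
    using assms
  proof (induction J rule: finite_induct)
    case empty
    then show ?case by auto
  next
    case (insert x J)
    obtain A B where AB: "A \<union> B = J" "A \<inter> B = {}" "sum b B \<le> sum b A" "sum b A \<le> sum b B + M"
      using insert by auto
    have fin: "finite A" "finite B" and x: "x \<notin> A" "x \<notin> B"
      using AB insert.hyps by auto
    have x': "b x \<le> M" using insert.prems by simp
    show ?case
    proof (cases "sum b (insert x B) \<le> sum b A")
      case True
      then show ?thesis
        by (intro exI[of _ A] exI[of _ "insert x B"]) (use AB x fin in auto)
    next
      case False
      then show ?thesis
        by (intro exI[of _ "insert x B"] exI[of _ A]) (use AB x x' fin in auto)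
    qed
  qed
  then show ?thesis using that by blast
qed

section \<open>Means, supports and the averaging argument for decreasing lists\<close>

locale decreasing_families =
  fixes J :: "'j set" and a :: "'j \<Rightarrow> nat \<Rightarrow> real" and n :: nat
  assumes finite_J: "finite J"
    and n_pos: "n > 0"
    and nonneg: "\<And>j k. j \<in> J \<Longrightarrow> k < n \<Longrightarrow> 0 \<le> a j k"
    and le_one: "\<And>j k. j \<in> J \<Longrightarrow> k < n \<Longrightarrow> a j k \<le> 1"
    and decreasing: "\<And>j i k. j \<in> J \<Longrightarrow> i \<le> k \<Longrightarrow> k < n \<Longrightarrow> a j k \<le> a j i"
    and first_pos: "\<And>j. j \<in> J \<Longrightarrow> a j 0 > 0"
begin

definition mean :: "'j \<Rightarrow> real" where
  "mean j = (\<Sum>k<n. a j k) / real n"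

text \<open>The maximum is over a non-empty set by \<open>first_pos\<close>. As the list decreases,
  its support is the initial segment ending here, so capping a position at \<open>last_pos j\<close>
  makes its value positive without lowering it.\<close>

definition last_pos :: "'j \<Rightarrow> nat" where
  "last_pos j = Max {k. k < n \<and> a j k > 0}"

lemma last_pos_lt: "j \<in> J \<Longrightarrow> last_pos j < n"
  and last_pos_gt_0: "j \<in> J \<Longrightarrow> a j (last_pos j) > 0"
  and le_last_pos: "j \<in> J \<Longrightarrow> k < n \<Longrightarrow> a j k > 0 \<Longrightarrow> k \<le> last_pos j"
proof -
  have fin: "finite {k. k < n \<and> a j k > 0}" by simp
  {
    assume j: "j \<in> J"
    then have "last_pos j \<in> {k. k < n \<and> a j k > 0}"
      unfolding last_pos_def using first_pos n_pos by (intro Max_in fin) auto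
    then show "last_pos j < n" "a j (last_pos j) > 0" by auto
    show "k \<le> last_pos j" if "k < n" "a j k > 0"
      unfolding last_pos_def using that by (intro Max_ge fin) auto
  }
qed

lemma pos_if_le_last_pos:
  assumes "j \<in> J" "k \<le> last_pos j"
  shows "a j k > 0"
  using decreasing[OF assms last_pos_lt[OF assms(1)]] last_pos_gt_0[OF assms(1)] by linarith

lemma sum_eq_n_mean: "(\<Sum>k<n. a j k) = real n * mean j"
  using n_pos by (simp add: mean_def)

lemma n_mean_eq:
  assumes "j \<in> J"
  shows "real n * mean j = (\<Sum>k\<le>last_pos j. a j k)"
proof -
  have "(\<Sum>k<n. a j k) = (\<Sum>k\<le>last_pos j. a j k)"
  proof (rule sum.mono_neutral_right)
    show "\<forall>i\<in>{..<n} - {..last_pos j}. a j i = 0"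
      using le_last_pos[OF assms] nonneg[OF assms] by (force simp: order.order_iff_strict)
  qed (use last_pos_lt[OF assms] in auto)
  then show ?thesis by (simp add: sum_eq_n_mean)
qed

lemma mean_nonneg: "j \<in> J \<Longrightarrow> mean j \<ge> 0"
  unfolding mean_def by (intro divide_nonneg_nonneg sum_nonneg) (auto intro: nonneg)

text \<open>The \<open>last_pos j\<close> earlier values are at most 1 each, so the last positive
  one has to carry what is left of the total mass.\<close>

lemma value_at_last_pos:
  assumes "j \<in> J"
  shows "a j (last_pos j) \<ge> real n * mean j - real (last_pos j)"
proof -
  have "(\<Sum>k<last_pos j. a j k) \<le> (\<Sum>k<last_pos j. 1)"
    using last_pos_lt[OF assms] by (intro sum_mono le_one[OF assms]) auto
  moreover have "(\<Sum>k\<le>last_pos j. a j k) = (\<Sum>k<last_pos j. a j k) + a j (last_pos j)"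
    by (simp add: lessThan_Suc_atMost[symmetric])
  ultimately show ?thesis using n_mean_eq[OF assms] by simp
qed

lemma n_mean_le:
  assumes "j \<in> J"
  shows "real n * mean j \<le> real (Suc (last_pos j)) * a j 0"
proof -
  have "(\<Sum>k\<le>last_pos j. a j k) \<le> (\<Sum>k\<le>last_pos j. a j 0)"
    using last_pos_lt[OF assms] by (intro sum_mono decreasing[OF assms]) auto
  then show ?thesis using n_mean_eq[OF assms] by simp
qed

text \<open>A permutation preserves the sum of a list, so the coupled sum averages over
  \<open>u\<close> to the sum of the means, and some \<open>u\<close> reaches this average.\<close>

lemma average_choice:
  assumes K: "K \<subseteq> J" and bij: "\<And>j. j \<in> K \<Longrightarrow> bij_betw (\<pi> j) {..<n} {..<n}"
  obtains u where "u < n" "(\<Sum>j\<in>K. a j (\<pi> j u)) \<ge> sum mean K"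
proof -
  have "\<exists>u<n. (\<Sum>j\<in>K. a j (\<pi> j u)) \<ge> sum mean K"
  proof (rule ccontr)
    assume "\<not> ?thesis"
    then have "(\<Sum>u<n. \<Sum>j\<in>K. a j (\<pi> j u)) < (\<Sum>u<n. sum mean K)"
      using n_pos by - (rule sum_strict_mono, auto simp: not_le)
    moreover have "(\<Sum>u<n. \<Sum>j\<in>K. a j (\<pi> j u)) = (\<Sum>j\<in>K. \<Sum>u<n. a j (\<pi> j u))"
      by (rule sum.swap)
    moreover have "\<dots> = (\<Sum>j\<in>K. real n * mean j)"
      using sum.reindex_bij_betw[OF bij, of _ "a _"] by (intro sum.cong) (auto simp: sum_eq_n_mean)
    ultimately show False by (simp add: sum_distrib_left)
  qed
  then show ?thesis using that by blast
qed

text \<open>The averaging argument gives no control over which \<open>u\<close> is found, so the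
  bound on the capped positions is required for every \<open>u\<close>.\<close>

lemma truncated_average_choice:
  assumes bij: "\<And>j. j \<in> J \<Longrightarrow> bij_betw (\<pi> j) {..<n} {..<n}"
    and N: "\<And>u. u < n \<Longrightarrow> N \<le> (\<Sum>j\<in>J. min (\<pi> j u) (last_pos j))"
  obtains k where "\<And>j. j \<in> J \<Longrightarrow> k j \<le> last_pos j" "N \<le> sum k J"
    "(\<Sum>j\<in>J. a j (k j)) \<ge> sum mean J"
proof -
  obtain u where u: "u < n" "(\<Sum>j\<in>J. a j (\<pi> j u)) \<ge> sum mean J"
    using average_choice[OF order_refl, of \<pi>] bij by blast
  have lt: "\<pi> j u < n" if "j \<in> J" for j
    using bij_betw_apply[OF bij[OF that]] u(1) by auto
  have "(\<Sum>j\<in>J. a j (\<pi> j u)) \<le> (\<Sum>j\<in>J. a j (min (\<pi> j u) (last_pos j)))"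
    by (intro sum_mono decreasing lt) auto
  then show ?thesis
    using that[of "\<lambda>j. min (\<pi> j u) (last_pos j)"] u N by fastforce
qed

end

section \<open>Explicit permutations for five summands\<close>

lemma bij_betw_reflect: "bij_betw (\<lambda>u. n - Suc u) {..<n} {..<n::nat}"
  by (rule bij_betw_byWitness[where f' = "\<lambda>u. n - Suc u"]) auto

text \<open>The cyclic rotation by \<open>n div 2\<close>, written piecewise instead of with
  \<open>mod\<close> so that each branch is linear.\<close>

lemma bij_betw_halfshift:
  "bij_betw (\<lambda>u. if u < n - n div 2 then u + n div 2 else u - (n - n div 2)) {..<n} {..<n::nat}"
proof -
  let ?h = "n div 2"
  have "?h \<le> n" by simp
  then show ?thesis
    by (intro bij_betw_byWitness[where f' = "\<lambda>v. if v < ?h then v + (n - ?h) else v - ?h"]) (auto split: if_splits)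
qed

text \<open>The first half of the arguments runs downwards through the even numbers, the second half
  downwards through the odd ones, so parity separates the branches. The slope \<open>-2\<close>
  serves to balance two maps of slope 1.\<close>

lemma bij_betw_double_reflect:
  "bij_betw (\<lambda>u. if u < n - n div 2 then 2 * (n - n div 2 - 1 - u) else 2 * n - 1 - 2 * u) {..<n} {..<n::nat}"
  (is "bij_betw ?f _ _")
proof -
  have "inj_on ?f {..<n}"
  proof (rule inj_onI)
    fix x y assume "x \<in> {..<n}" "y \<in> {..<n}" "?f x = ?f y"
    then show "x = y" by (simp split: if_splits) presburger+
  qed
  moreover have "?f ` {..<n} \<subseteq> {..<n}"
    by (auto; presburger)
  ultimately show ?thesis
    unfolding bij_betw_def using endo_inj_surj[of "{..<n}" ?f] by blast
qed

text \<open>An identity and the reflection add up to \<open>n - 1\<close>. A second identity and the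
  rotation \<open>V\<close> have slope 1 each, which \<open>W\<close> cancels, so the total is
  constant on each half: \<open>2 * n + (n - n div 2) - 3\<close> on the first and
  \<open>2 * n + n div 2 - 2\<close> on the second. Both are at least \<open>2 * n\<close> once
  \<open>n \<ge> 5\<close>.\<close>

lemma five_permutations:
  fixes n :: nat
  assumes "card J = 5" and n: "n \<ge> 5"
  obtains \<pi> :: "'j \<Rightarrow> nat \<Rightarrow> nat" where "\<And>j. bij_betw (\<pi> j) {..<n} {..<n}"
    "\<And>u. u < n \<Longrightarrow> 2 * n \<le> (\<Sum>j\<in>J. \<pi> j u)"
proof -
  obtain p q r v w where J: "J = {p, q, r, v, w}" and dist: "distinct [p, q, r, v, w]"
  proof -
    obtain xs where xs: "set xs = J" "distinct xs"
      using assms(1) by (metis card.infinite finite_distinct_list zero_neq_numeral)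
    then have "length xs = 5" using assms(1) distinct_card by metis
    then show ?thesis using xs that by (auto simp: numeral_eq_Suc length_Suc_conv)
  qed
  define V where "V u = (if u < n - n div 2 then u + n div 2 else u - (n - n div 2))" for u
  define W where "W u = (if u < n - n div 2 then 2 * (n - n div 2 - 1 - u) else 2 * n - 1 - 2 * u)" for u
  define \<pi> where "\<pi> j = (if j = q then (\<lambda>u. n - Suc u) else if j = v then V else if j = w then W else id)" for j
  have bij: "bij_betw (\<pi> j) {..<n} {..<n}" for j
    unfolding \<pi>_def V_def W_def
    using bij_betw_reflect bij_betw_halfshift bij_betw_double_reflect bij_betw_id by simp
  have "2 * n \<le> (\<Sum>j\<in>J. \<pi> j u)" if "u < n" for u
  proof -
    have "(\<Sum>j\<in>J. \<pi> j u) = u + (n - Suc u) + u + V u + W u"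
      using dist by (auto simp: J \<pi>_def)
    also have "\<dots> \<ge> 2 * n"
      using that n unfolding V_def W_def by (auto split: if_splits)
    finally show ?thesis .
  qed
  with bij show ?thesis using that by blast
qed

context decreasing_families
begin

text \<open>With total loss below 1/2 no chosen value can vanish, so the support plays no role.\<close>

lemma choice_five:
  assumes card: "card J = 5" and n: "n \<ge> 5" and D: "D \<ge> 9/2" and T: "sum mean J > D"
  obtains k where "\<And>j. j \<in> J \<Longrightarrow> k j < n" "\<And>j. j \<in> J \<Longrightarrow> a j (k j) > 0" "2 * n \<le> sum k J"
    "(\<Sum>j\<in>J. a j (k j)) > D"
proof -
  obtain \<pi> :: "'j \<Rightarrow> nat \<Rightarrow> nat" where bij: "\<And>j. bij_betw (\<pi> j) {..<n} {..<n}"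
    and N: "\<And>u. u < n \<Longrightarrow> 2 * n \<le> (\<Sum>j\<in>J. \<pi> j u)"
    using five_permutations[OF card n] by blast
  obtain u where u: "u < n" "(\<Sum>j\<in>J. a j (\<pi> j u)) \<ge> sum mean J"
    using average_choice[OF order_refl, of \<pi>] bij by blast
  have lt: "\<pi> j u < n" for j
    using bij_betw_apply[OF bij] u(1) by auto
  have "a j (\<pi> j u) > 0" if j: "j \<in> J" for j
  proof -
    have "(\<Sum>i\<in>J - {j}. a i (\<pi> i u)) \<le> (\<Sum>i\<in>J - {j}. 1)"
      by (intro sum_mono le_one lt) auto
    also have "\<dots> = 4" using card j by simp
    finally show ?thesis
      using u(2) T D sum.remove[OF finite_J j, of "\<lambda>i. a i (\<pi> i u)"] by linarith
  qed
  then show ?thesis using that[of "\<lambda>j. \<pi> j u"] u T lt N by fastforce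
qed

section \<open>Couplings truncated to the support, for sums of means above five\<close>

lemma choice_last_pos:
  assumes "real (\<Sum>j\<in>J. last_pos j) \<le> (real n - 1) * sum mean J"
  shows "(\<Sum>j\<in>J. a j (last_pos j)) \<ge> sum mean J"
proof -
  \<comment> \<open>The sum of these lower bounds is \<open>n\<close> times the total mean minus the
    sum of the \<open>last_pos j\<close>; the assumption says exactly that this is at least the
    total mean.\<close>
  have "(\<Sum>j\<in>J. a j (last_pos j)) \<ge> (\<Sum>j\<in>J. real n * mean j - real (last_pos j))"
    by (intro sum_mono value_at_last_pos)
  also have "(\<Sum>j\<in>J. real n * mean j - real (last_pos j)) = real n * sum mean J - real (\<Sum>j\<in>J. last_pos j)"
    by (simp add: sum_subtractf sum_distrib_left)
  finally show ?thesis using assms by (simp add: algebra_simps)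
qed

text \<open>For \<open>u\<close> and \<open>b\<close> both at most \<open>n - 1\<close> one has
  \<open>u * b \<le> (n - 1) * min u b\<close>: capping at \<open>u\<close> retains at least the
  fraction \<open>u / (n - 1)\<close> of \<open>b\<close>.\<close>

lemma scaled_truncated_sum:
  assumes "A \<subseteq> J" and u: "u < n"
  shows "u * sum last_pos A \<le> (n - 1) * (\<Sum>j\<in>A. min u (last_pos j))"
proof -
  have "u * last_pos j \<le> (n - 1) * min u (last_pos j)" if "j \<in> A" for j
  proof -
    have "last_pos j \<le> n - 1" using last_pos_lt[of j] that assms by auto
    then show ?thesis using u
      by (cases "u \<le> last_pos j") (auto simp: mult.commute intro: mult_le_mono)
  qed
  then show ?thesis by (simp add: sum_distrib_left sum_mono)
qed

text \<open>Up to the factor \<open>n - 1\<close>, the left side interpolates linearly between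
  \<open>sum last_pos B\<close> at \<open>u = 0\<close> and \<open>sum last_pos A\<close> at
  \<open>u = n - 1\<close>.\<close>

lemma antithetic_sum_ge:
  assumes AB: "A \<union> B = J" "A \<inter> B = {}" and u: "u < n"
  shows "u * sum last_pos A + (n - Suc u) * sum last_pos B
    \<le> (n - 1) * ((\<Sum>j\<in>A. min u (last_pos j)) + (\<Sum>j\<in>B. min (n - Suc u) (last_pos j)))"
  unfolding add_mult_distrib2 using AB u
  by (intro add_mono scaled_truncated_sum) auto

text \<open>If both endpoints of the interpolation in \<open>antithetic_sum_ge\<close> are at least
  \<open>N\<close>, so is every value in between.\<close>

lemma choice_antithetic:
  assumes AB: "A \<union> B = J" "A \<inter> B = {}" and n: "n \<ge> 2"
    and A: "N \<le> sum last_pos A" and B: "N \<le> sum last_pos B"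
  obtains k where "\<And>j. j \<in> J \<Longrightarrow> k j \<le> last_pos j" "N \<le> sum k J"
    "(\<Sum>j\<in>J. a j (k j)) \<ge> sum mean J"
proof -
  define \<pi> where "\<pi> j = (if j \<in> A then id else (\<lambda>u. n - Suc u))" for j
  have bij: "bij_betw (\<pi> j) {..<n} {..<n}" for j
    unfolding \<pi>_def using bij_betw_reflect by simp
  have "N \<le> (\<Sum>j\<in>J. min (\<pi> j u) (last_pos j))" if u: "u < n" for u
  proof -
    have fin: "finite A" "finite B" using AB finite_J by auto
    have eq: "(\<Sum>j\<in>J. min (\<pi> j u) (last_pos j)) = (\<Sum>j\<in>A. min u (last_pos j)) + (\<Sum>j\<in>B. min (n - Suc u) (last_pos j))"
      unfolding AB(1)[symmetric] sum.union_disjoint[OF fin AB(2)]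
      using AB(2) by (intro arg_cong2[of _ _ _ _ "(+)"] sum.cong) (auto simp: \<pi>_def)
    have "(n - 1) * N = u * N + (n - Suc u) * N"
      using u by (simp add: add_mult_distrib[symmetric])
    also have "\<dots> \<le> u * sum last_pos A + (n - Suc u) * sum last_pos B"
      using A B by (intro add_mono mult_le_mono) auto
    also have "\<dots> \<le> (n - 1) * (\<Sum>j\<in>J. min (\<pi> j u) (last_pos j))"
      unfolding eq by (rule antithetic_sum_ge[OF AB u])
    finally have "(n - 1) * N \<le> (n - 1) * (\<Sum>j\<in>J. min (\<pi> j u) (last_pos j))" .
    then show ?thesis using n by simp
  qed
  then show ?thesis using truncated_average_choice[of \<pi> N, OF bij] that by blast
qed

text \<open>The antithetic coupling misses the target by one, and only at \<open>u = 0\<close>; exchanging the values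
  at \<open>0\<close> and \<open>1\<close> for a single index of \<open>A\<close> repairs this.\<close>

lemma choice_antithetic_swap:
  assumes AB: "A \<union> B = J" "A \<inter> B = {}" and n: "n \<ge> 3"
    and A: "3 * n - 3 \<le> sum last_pos A" and B: "sum last_pos B = 2 * n - 1"
    and cards: "card {j \<in> B. last_pos j = n - 1} + 2 \<le> card {j \<in> A. last_pos j > 0}"
  obtains k where "\<And>j. j \<in> J \<Longrightarrow> k j \<le> last_pos j" "2 * n \<le> sum k J"
    "(\<Sum>j\<in>J. a j (k j)) \<ge> sum mean J"
proof -
  have fin: "finite A" "finite B" using AB finite_J by auto
  obtain i where i: "i \<in> A" "last_pos i > 0"
    using cards by (metis (mono_tags, lifting) add_leE card.empty empty_Collect_eq not_numeral_le_zero)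
  define \<pi> where "\<pi> j = (if j = i then (\<lambda>u. if u = 0 then 1 else if u = 1 then 0 else u) else if j \<in> A then id else (\<lambda>u. n - Suc u))" for j
  have bij: "bij_betw (\<pi> j) {..<n} {..<n}" for j
  proof -
    have "bij_betw (\<lambda>u. if u = 0 then 1 else if u = 1 then 0 else u) {..<n} {..<n}" (is "bij_betw ?f _ _")
      using n by (intro bij_betw_byWitness[where f' = ?f]) (auto split: if_splits)
    then show ?thesis unfolding \<pi>_def using bij_betw_reflect by simp
  qed
  have split: "(\<Sum>j\<in>J. min (\<pi> j u) (last_pos j)) =
      min (\<pi> i u) (last_pos i) + (\<Sum>j\<in>A - {i}. min u (last_pos j)) + (\<Sum>j\<in>B. min (n - Suc u) (last_pos j))" for u
  proof -
    have "(\<Sum>j\<in>J. min (\<pi> j u) (last_pos j)) =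
       (\<Sum>j\<in>A. min (\<pi> j u) (last_pos j)) + (\<Sum>j\<in>B. min (\<pi> j u) (last_pos j))"
      unfolding AB(1)[symmetric] by (rule sum.union_disjoint[OF fin AB(2)])
    moreover have "(\<Sum>j\<in>B. min (\<pi> j u) (last_pos j)) = (\<Sum>j\<in>B. min (n - Suc u) (last_pos j))"
      using i AB(2) by (intro sum.cong) (auto simp: \<pi>_def)
    moreover have "(\<Sum>j\<in>A. min (\<pi> j u) (last_pos j)) = min (\<pi> i u) (last_pos i) + (\<Sum>j\<in>A - {i}. min (\<pi> j u) (last_pos j))"
      by (rule sum.remove[OF fin(1) i(1)])
    moreover have "(\<Sum>j\<in>A - {i}. min (\<pi> j u) (last_pos j)) = (\<Sum>j\<in>A - {i}. min u (last_pos j))"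
      by (intro sum.cong) (auto simp: \<pi>_def)
    ultimately show ?thesis by simp
  qed
  have "2 * n \<le> (\<Sum>j\<in>J. min (\<pi> j u) (last_pos j))" if u: "u < n" for u
  proof -
    consider "u = 0" | "u = 1" | "u \<ge> 2" by linarith
    then show ?thesis
    proof cases
      case 1
      \<comment> \<open>\<open>B\<close> contributes all of \<open>2 * n - 1\<close>, and the
        missing 1 comes from the swapped index \<open>i\<close>, which sits at position 1.\<close>
      have "(\<Sum>j\<in>B. min (n - 1) (last_pos j)) = sum last_pos B"
        using last_pos_lt AB(1) by (intro sum.cong) fastforce+
      then show ?thesis using 1 split[of 0] B i by (simp add: \<pi>_def)
    next
      case 2
      \<comment> \<open>At \<open>u = 1\<close> the index \<open>i\<close> contributes 0 and every
        other index of \<open>A\<close> with positive \<open>last_pos\<close> contributes 1, while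
        \<open>B\<close> loses 1 for each index with \<open>last_pos j = n - 1\<close>. The
        assumption \<open>cards\<close> is what makes the balance reach
        \<open>2 * n\<close>.\<close>
      have "(\<Sum>j\<in>A. min 1 (last_pos j)) = (\<Sum>j\<in>A. if last_pos j > 0 then 1 else 0)"
        by (intro sum.cong) auto
      also have "\<dots> = card {j \<in> A. last_pos j > 0}"
        using fin by (simp add: sum.If_cases Int_def)
      finally have g: "(\<Sum>j\<in>A - {i}. min 1 (last_pos j)) + 1 = card {j \<in> A. last_pos j > 0}"
        using sum.remove[OF fin(1) i(1), of "\<lambda>j. min 1 (last_pos j)"] i by simp
      have "sum last_pos B = (\<Sum>j\<in>B. min (n - 2) (last_pos j) + (if last_pos j = n - 1 then 1 else 0))"
      proof (rule sum.cong)
        fix j assume "j \<in> B"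
        then have "last_pos j < n" using last_pos_lt AB by auto
        then show "last_pos j = min (n - 2) (last_pos j) + (if last_pos j = n - 1 then 1 else 0)"
          using n by auto
      qed simp
      also have "\<dots> = (\<Sum>j\<in>B. min (n - 2) (last_pos j)) + card {j \<in> B. last_pos j = n - 1}"
        using fin by (simp add: sum.distrib sum.If_cases Int_def)
      finally have f: "(\<Sum>j\<in>B. min (n - 2) (last_pos j)) + card {j \<in> B. last_pos j = n - 1} = 2 * n - 1"
        using B by simp
      have "(\<Sum>j\<in>J. min (\<pi> j u) (last_pos j)) = 
        (\<Sum>j\<in>A - {i}. min 1 (last_pos j)) + (\<Sum>j\<in>B. min (n - 2) (last_pos j))"
        using split[of 1] 2 by (simp add: \<pi>_def numeral_2_eq_2)
      then show ?thesis using f g cards n by linarith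
    next
      case 3
      then have "\<pi> i u = u" by (simp add: \<pi>_def)
      then have eq: "(\<Sum>j\<in>J. min (\<pi> j u) (last_pos j)) = (\<Sum>j\<in>A. min u (last_pos j)) + (\<Sum>j\<in>B. min (n - Suc u) (last_pos j))"
        using split[of u] sum.remove[OF fin(1) i(1), of "\<lambda>j. min u (last_pos j)"] by simp
      have "u * (3 * n - 3) + (n - Suc u) * (2 * n - 1) \<le> u * sum last_pos A + (n - Suc u) * sum last_pos B"
        using A B by (intro add_mono mult_le_mono) auto
      also have "\<dots> \<le> (n - 1) * (\<Sum>j\<in>J. min (\<pi> j u) (last_pos j))"
        unfolding eq by (rule antithetic_sum_ge[OF AB u])
      finally have "u * (3 * n - 3) + (n - Suc u) * (2 * n - 1) \<le> (n - 1) * (\<Sum>j\<in>J. min (\<pi> j u) (last_pos j))" .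
      \<comment> \<open>The surplus \<open>u * (n - 2)\<close> is positive, so the total strictly
        exceeds \<open>2 * n - 1\<close>.\<close>
      moreover have "u * (3 * n - 3) + (n - Suc u) * (2 * n - 1) = (n - 1) * (2 * n - 1) + u * (n - 2)"
      proof -
        obtain w where w: "n = Suc (u + w)" using u less_iff_Suc_add by auto
        with 3 obtain v where v: "u = v + 2" by (metis add.commute le_Suc_ex)
        show ?thesis unfolding w v by (simp add: algebra_simps)
      qed
      moreover have "u * (n - 2) > 0" using 3 n by simp
      ultimately have "(n - 1) * (2 * n - 1) < (n - 1) * (\<Sum>j\<in>J. min (\<pi> j u) (last_pos j))" by linarith
      then show ?thesis by auto
    qed
  qed
  then show ?thesis using truncated_average_choice[of \<pi> "2 * n", OF bij] that by blast
qed

text \<open>For \<open>n = 3\<close> no coupling with uniform marginals reaches \<open>2 * n\<close> here. Instead the long family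
  with the largest mean is pushed to its end; the short families, which keep their first values, pay for it.\<close>

lemma choice_five_full:
  assumes F: "F \<subseteq> J" "card F = 5" and full: "\<And>j. j \<in> F \<Longrightarrow> last_pos j = n - 1"
    and short: "\<And>j. j \<in> J - F \<Longrightarrow> last_pos j \<le> 1"
    and n: "n \<ge> 3" and T: "sum mean J > 5"
  obtains k where "\<And>j. j \<in> J \<Longrightarrow> k j \<le> last_pos j" "2 * n \<le> sum k J"
    "(\<Sum>j\<in>J. a j (k j)) \<ge> sum mean J"
proof -
  have fin: "finite F" and ne: "F \<noteq> {}"
    using F finite_J finite_subset by auto
  then have "Max (mean ` F) \<in> mean ` F" by (intro Max_in) auto
  then obtain i where i: "i \<in> F" "mean i = Max (mean ` F)" by force
  have max: "mean j \<le> mean i" if "j \<in> F" for j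
    using that fin i by simp
  have iJ: "i \<in> J" using i F by auto
  have "card (F - {i}) = 4" using F i fin by simp
  then obtain P where P: "P \<subseteq> F - {i}" "card P = 2"
    by (metis obtain_subset_with_card_n numeral_le_iff semiring_norm(68,71))
  define Q where "Q = F - {i} - P"
  have Q: "card Q = 2" "P \<inter> Q = {}" "P \<union> Q = F - {i}"
    using P fin \<open>card (F - {i}) = 4\<close> unfolding Q_def
    by (auto simp: card_Diff_subset finite_subset)
  have finPQ: "finite P" "finite Q" using P Q fin by (auto simp: Q_def finite_subset)
  define \<pi> where "\<pi> j = (if j \<in> P then id else (\<lambda>u. n - Suc u))" for j
  have bij: "bij_betw (\<pi> j) {..<n} {..<n}" for j
    unfolding \<pi>_def using bij_betw_reflect by simp
  obtain u where u: "u < n" "(\<Sum>j\<in>F - {i}. a j (\<pi> j u)) \<ge> sum mean (F - {i})"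
    using average_choice[of "F - {i}" \<pi>] F bij by (metis Diff_subset subset_trans)
  \<comment> \<open>Index \<open>i\<close> contributes \<open>n - 1\<close> and the pairs
    \<open>P\<close> and \<open>Q\<close> together \<open>2 * (n - 1)\<close>, which is enough since
    \<open>3 * (n - 1) \<ge> 2 * n\<close>. The short families sit at 0, where their values are
    largest.\<close>
  define k where "k j = (if j = i then n - 1 else if j \<in> F then \<pi> j u else 0)" for j
  have "k j \<le> last_pos j" if "j \<in> J" for j
    using full[of j] i u(1) by (auto simp: k_def \<pi>_def)
  moreover have "2 * n \<le> sum k J"
  proof -
    have "sum k J \<ge> sum k F" using F finite_J by (intro sum_mono2) auto
    moreover have "sum k F = k i + (sum k P + sum k Q)"
      using sum.remove[OF fin i(1), of k] sum.union_disjoint[OF finPQ Q(2), of k] Q(3) by simp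
    moreover have "sum k P = (\<Sum>j\<in>P. u)"
      using P by (intro sum.cong) (auto simp: k_def \<pi>_def)
    moreover have "sum k Q = (\<Sum>j\<in>Q. n - Suc u)"
      by (intro sum.cong) (auto simp: k_def \<pi>_def Q_def)
    moreover have "k i = n - 1" by (simp add: k_def)
    ultimately have "n - 1 + (2 * u + 2 * (n - Suc u)) \<le> sum k J" using P Q by simp
    then show ?thesis using n u by linarith
  qed
  moreover have "(\<Sum>j\<in>J. a j (k j)) \<ge> sum mean J"
  proof -
    define R where "R = sum mean (J - F)"
    have split: "sum h J = h i + sum h (F - {i}) + sum h (J - F)" for h :: "'j \<Rightarrow> real"
      using sum.subset_diff[OF F(1) finite_J, of h] sum.remove[OF fin i(1), of h] by simp
    have "real n / 2 * mean j \<le> a j 0" if j: "j \<in> J - F" for j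
    proof -
      have "real n * mean j \<le> real (Suc (last_pos j)) * a j 0" using n_mean_le j by auto
      also have "\<dots> \<le> 2 * a j 0"
        using short[OF j] first_pos[of j] j by (intro mult_right_mono) auto
      finally show ?thesis by simp
    qed
    then have "real n / 2 * R \<le> (\<Sum>j\<in>J - F. a j 0)"
      unfolding R_def sum_distrib_left by (intro sum_mono)
    also have "\<dots> = (\<Sum>j\<in>J - F. a j (k j))"
      using i by (intro sum.cong) (auto simp: k_def)
    finally have 1: "real n / 2 * R \<le> (\<Sum>j\<in>J - F. a j (k j))" .
    have "(\<Sum>j\<in>F - {i}. a j (\<pi> j u)) = (\<Sum>j\<in>F - {i}. a j (k j))"
      by (intro sum.cong) (auto simp: k_def)
    then have 2: "sum mean (F - {i}) \<le> (\<Sum>j\<in>F - {i}. a j (k j))" using u by simp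
    have 3: "real n * mean i - (real n - 1) \<le> a i (k i)"
      using value_at_last_pos[OF iJ] full[OF i(1)] n by (simp add: k_def of_nat_diff)
    \<comment> \<open>Compared with the means, \<open>i\<close> loses at most
      \<open>(n - 1) * (1 - mean i)\<close> and the short families gain at least
      \<open>(n / 2 - 1) * R\<close>. As \<open>mean i\<close> is maximal in \<open>F\<close> and
      the total exceeds 5, \<open>5 * (1 - mean i) \<le> R\<close>; the gain covers the loss because
      \<open>n - 1 \<le> 5 * (n / 2 - 1)\<close> for \<open>n \<ge> 3\<close>.\<close>
    have "sum mean F \<le> 5 * mean i"
      using sum_bounded_above[of F mean "mean i"] max F by simp
    then have "5 * (1 - mean i) \<le> R"
      using T sum.subset_diff[OF F(1) finite_J, of mean] by (simp add: R_def)
    then have "(real n - 1) * (5 * (1 - mean i)) \<le> (real n - 1) * R"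
      using n by (intro mult_left_mono) auto
    moreover have "(real n - 1) * R \<le> 5 * (real n / 2 - 1) * R"
    proof (rule mult_right_mono)
      show "0 \<le> R" unfolding R_def by (intro sum_nonneg mean_nonneg) auto
    qed (use n in auto)
    ultimately have "real n * mean i - (real n - 1) + real n / 2 * R \<ge> mean i + R"
      by (simp add: algebra_simps)
    then show ?thesis
      using 1 2 3 split[of mean] split[of "\<lambda>j. a j (k j)"] by (simp add: R_def)
  qed
  ultimately show ?thesis using that by blast
qed

text \<open>Either the last positive positions work, with \<open>budget\<close> bounding their sum
  from below, or the supports are so long that an antithetic coupling works. What both leave over is
  an extremal configuration with five full supports.\<close>

lemma choice_gt_five:
  assumes n: "n \<ge> 3" and T: "sum mean J > 5"
    and budget: "real n * sum mean J \<ge> 2 * real n + real (card J)"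
  obtains k where "\<And>j. j \<in> J \<Longrightarrow> k j \<le> last_pos j" "2 * n \<le> sum k J"
    "(\<Sum>j\<in>J. a j (k j)) \<ge> sum mean J"
proof (cases "real (sum last_pos J) \<le> (real n - 1) * sum mean J")
  case True
  have "real n * mean j \<le> real (last_pos j) + 1" if "j \<in> J" for j
  proof -
    have ub: "real (Suc (last_pos j)) * a j 0 \<le> real (Suc (last_pos j)) * 1"
      using le_one[OF that, of 0] n_pos by (intro mult_left_mono) auto
    then show ?thesis using order_trans[OF n_mean_le[OF that] ub] by simp
  qed
  then have "(\<Sum>j\<in>J. real n * mean j) \<le> (\<Sum>j\<in>J. real (last_pos j) + 1)"
    by (intro sum_mono)
  then have "real n * sum mean J \<le> real (sum last_pos J) + real (card J)"
    by (simp add: sum_distrib_left sum.distrib)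
  then have "2 * n \<le> sum last_pos J" using budget by linarith
  then show ?thesis using that[of last_pos] choice_last_pos[OF True] by simp
next
  case False
  \<comment> \<open>As positions are integers, a sum above \<open>5 * (n - 1)\<close> is at least
    \<open>5 * n - 4\<close>.\<close>
  have "(real n - 1) * 5 \<le> (real n - 1) * sum mean J"
    using n T by (intro mult_left_mono) auto
  then have "(real n - 1) * 5 < real (sum last_pos J)" using False by linarith
  then have "real (5 * n) < real (sum last_pos J + 5)" by simp
  then have "5 * n < sum last_pos J + 5" by (rule of_nat_less_imp_less)
  then have total: "5 * n - 4 \<le> sum last_pos J" by simp
  have le: "last_pos j \<le> n - 1" if "j \<in> J" for j
    using last_pos_lt[OF that] by linarith
  have bound: "sum last_pos X \<le> card X * (n - 1)" if "X \<subseteq> J" for X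
  proof -
    have "sum last_pos X \<le> of_nat (card X) * (n - 1)"
      using that le by (intro sum_bounded_above) auto
    then show ?thesis by simp
  qed
  obtain A B where AB: "A \<union> B = J" "A \<inter> B = {}" and
    bal: "sum last_pos B \<le> sum last_pos A" "sum last_pos A \<le> sum last_pos B + (n - 1)"
    by (rule balanced_partition[of J last_pos "n - 1", OF finite_J le])
  have fin: "finite A" "finite B" using AB finite_J by auto
  have sum_AB: "sum last_pos J = sum last_pos A + sum last_pos B"
    unfolding AB(1)[symmetric] by (rule sum.union_disjoint[OF fin AB(2)])
  show ?thesis
  proof (cases "2 * n \<le> sum last_pos B")
    case True
    moreover have "2 \<le> n" "2 * n \<le> sum last_pos A" using n bal True by auto
    ultimately show ?thesis using choice_antithetic[OF AB, of "2 * n"] that by blast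
  next
    case False
    \<comment> \<open>The parts differ by at most \<open>n - 1\<close>, so twice the sum over
      \<open>B\<close> is at least \<open>4 * n - 3\<close>, and rounding up leaves only the value
      \<open>2 * n - 1\<close>.\<close>
    then have B: "sum last_pos B = 2 * n - 1" and A: "3 * n - 3 \<le> sum last_pos A"
      using total sum_AB bal n by linarith+
    define A1 where "A1 = {j \<in> A. last_pos j > 0}"
    define B1 where "B1 = {j \<in> B. last_pos j = n - 1}"
    have sub: "A1 \<subseteq> J" "B1 \<subseteq> J" "finite A1" "finite B1" "B1 \<subseteq> B"
      using AB fin by (auto simp: A1_def B1_def)
    have sumA1: "sum last_pos A = sum last_pos A1"
      unfolding A1_def using fin by (intro sum.mono_neutral_right) auto
    have sumB1: "sum last_pos B1 = card B1 * (n - 1)"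
      by (simp add: B1_def)
    have sumB: "sum last_pos B = sum last_pos (B - B1) + card B1 * (n - 1)"
      using sum.subset_diff[OF sub(5) fin(2), of last_pos] sumB1 by simp
    have "3 * (n - 1) \<le> sum last_pos A1" using A sumA1 by linarith
    also have "\<dots> \<le> card A1 * (n - 1)" by (rule bound[OF sub(1)])
    finally have "3 * (n - 1) \<le> card A1 * (n - 1)" .
    then have g: "3 \<le> card A1" using n by simp
    have "card B1 * (n - 1) < 3 * (n - 1)" using sumB B n by linarith
    then have f: "card B1 \<le> 2" by simp
    show ?thesis
    proof (cases "card B1 + 2 \<le> card A1")
      case True
      then show ?thesis
        using choice_antithetic_swap[OF AB n A B] that unfolding A1_def B1_def by blast
    next
      case False
      \<comment> \<open>Three indices now carry at least \<open>3 * (n - 1)\<close> in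
        \<open>A\<close>, so all three are full, while outside its two full indices \<open>B\<close>
        has only 1 left: five full families, all others short.\<close>
      then have cards: "card A1 = 3" "card B1 = 2" using f g by auto
      show ?thesis
      proof (rule choice_five_full[of "A1 \<union> B1", OF _ _ _ _ n T])
        show "card (A1 \<union> B1) = 5"
          using cards sub AB by (subst card_Un_disjoint) (auto simp: A1_def B1_def)
        show "last_pos j = n - 1" if "j \<in> A1 \<union> B1" for j
        proof (cases "j \<in> A1")
          case True
          have "sum last_pos (A1 - {j}) \<le> 2 * (n - 1)"
            using bound[of "A1 - {j}"] sub True cards by force
          then have "n - 1 \<le> last_pos j"
            using sum.remove[OF sub(3) True, of last_pos] A sumA1 by simp
          then show ?thesis using le[of j] True sub by force
        qed (use that in \<open>auto simp: B1_def\<close>)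
        show "last_pos j \<le> 1" if "j \<in> J - (A1 \<union> B1)" for j
        proof (cases "j \<in> B")
          case True
          then have "last_pos j \<le> sum last_pos (B - B1)"
            using that fin by (intro member_le_sum) auto
          then show ?thesis using sumB B cards n by simp
        qed (use that AB in \<open>auto simp: A1_def\<close>)
        show "A1 \<union> B1 \<subseteq> J" using sub by blast
      qed (rule that)
    qed
  qed
qed

lemma choice_above_threshold:
  assumes s: "card J = s" "s \<ge> 5" and n: "n \<ge> 3" "s = 5 \<Longrightarrow> n \<ge> 5"
    and T: "sum mean J > real s * threshold s"
  obtains k where "\<And>j. j \<in> J \<Longrightarrow> k j < n" "\<And>j. j \<in> J \<Longrightarrow> a j (k j) > 0" "2 * n \<le> sum k J"
    "(\<Sum>j\<in>J. a j (k j)) > real s * threshold s"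
proof (cases "s = 5")
  case True
  have thr: "real s * threshold s \<ge> 9 / 2" using True by (simp add: threshold_def)
  show ?thesis
    using choice_five[OF _ _ thr T] s n True that by blast
next
  case False
  define D where "D = real s * threshold s"
  \<comment> \<open>The second bound yields \<open>budget\<close> for every
    \<open>n \<ge> 3\<close>. The first is an equality at \<open>s = 6\<close> and
    \<open>s = 7\<close>.\<close>
  have D: "D \<ge> 5" "3 * (D - 2) \<ge> real s"
    using False s unfolding D_def threshold_def by (auto simp: field_simps)
  have "3 * (D - 2) \<le> real n * (D - 2)" using n D by (intro mult_right_mono) auto
  also have "\<dots> \<le> real n * (sum mean J - 2)" using T by (intro mult_left_mono) (auto simp: D_def)
  finally have "real n * sum mean J \<ge> 2 * real n + real (card J)"
    using D s by (simp add: algebra_simps)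
  moreover have "sum mean J > 5" using T D by (simp add: D_def)
  ultimately obtain k where k: "\<And>j. j \<in> J \<Longrightarrow> k j \<le> last_pos j" "2 * n \<le> sum k J"
    "(\<Sum>j\<in>J. a j (k j)) \<ge> sum mean J"
    using choice_gt_five[OF n(1)] by blast
  show ?thesis
  proof (rule that)
    show "k j < n" "a j (k j) > 0" if "j \<in> J" for j
      using k(1)[OF that] last_pos_lt[OF that] pos_if_le_last_pos[OF that] by auto
  qed (use k T in auto)
qed

end

section \<open>Reduction to prime moduli\<close>

text \<open>Least non-negative representatives stand in for cosets until the quotient ring returns.
  For \<open>m = 1\<close> this is \<open>{0}\<close>, in agreement with the zero ring.\<close>

definition unit_square_residues :: "int \<Rightarrow> int set" where
  "unit_square_residues m = {x \<in> {0..<m}. \<exists>y. coprime y m \<and> [x = y\<^sup>2] (mod m)}"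

lemma finite_unit_square_residues [simp]: "finite (unit_square_residues m)"
  unfolding unit_square_residues_def by (rule finite_subset[of _ "{0..<m}"]) auto

lemma unit_square_residues_subset: "unit_square_residues m \<subseteq> {0..<m}"
  by (auto simp: unit_square_residues_def)

lemma mod_mem_unit_square_residues:
  assumes "m > 0" "coprime y m" "[x = y\<^sup>2] (mod m)"
  shows "x mod m \<in> unit_square_residues m"
  using assms by (auto simp: unit_square_residues_def)

text \<open>The squares of \<open>1, ..., (p - 1) / 2\<close> are pairwise incongruent:
  \<open>p\<close> divides \<open>(x + y) * (x - y)\<close>, but
  \<open>0 < x + y < p\<close>.\<close>

lemma card_unit_square_residues:
  fixes p :: int
  assumes p: "prime p" "p > 2"
  shows "p - 1 \<le> 2 * int (card (unit_square_residues p))"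
proof -
  define h where "h = (p - 1) div 2"
  have "odd p" using prime_odd_int[OF p] .
  then have h: "p - 1 = 2 * h" unfolding h_def by presburger
  have "inj_on (\<lambda>y. y\<^sup>2 mod p) {1..h}"
  proof (rule inj_onI)
    fix x y assume xy: "x \<in> {1..h}" "y \<in> {1..h}" "x\<^sup>2 mod p = y\<^sup>2 mod p"
    then have "p dvd x\<^sup>2 - y\<^sup>2" by (simp add: mod_eq_dvd_iff)
    then have "p dvd (x + y) * (x - y)" by (simp add: power2_eq_square algebra_simps)
    moreover have "\<not> p dvd x + y" using xy h by (auto dest: zdvd_imp_le)
    ultimately have "p dvd x - y" using p prime_dvd_multD by blast
    then have "[x = y] (mod p)" by (simp add: cong_iff_dvd_diff)
    then show "x = y" using xy(1,2) h by (intro cong_less_imp_eq_int[of x p y]) auto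
  qed
  moreover have "(\<lambda>y. y\<^sup>2 mod p) ` {1..h} \<subseteq> unit_square_residues p"
  proof safe
    fix y assume y: "y \<in> {1..h}"
    then have "\<not> p dvd y" using h by (auto dest: zdvd_imp_le)
    then have "coprime y p" using prime_imp_coprime[OF p(1)] coprime_commute by blast
    then show "y\<^sup>2 mod p \<in> unit_square_residues p"
      using p by (intro mod_mem_unit_square_residues) auto
  qed
  ultimately have "card {1..h} \<le> card (unit_square_residues p)"
    by (metis card_image card_mono finite_unit_square_residues)
  then show ?thesis using h p by simp
qed

lemma obtain_decreasing_enumeration:
  fixes f :: "'a \<Rightarrow> real"
  assumes "finite X"
  obtains e where "bij_betw e {..<card X} X" "\<And>i k. i \<le> k \<Longrightarrow> k < card X \<Longrightarrow> f (e k) \<le> f (e i)"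
proof -
  obtain xs where xs: "set xs = X" "distinct xs" using finite_distinct_list[OF assms] by blast
  define ys where "ys = sort_key (\<lambda>x. - f x) xs"
  have ys: "set ys = X" "distinct ys" "sorted (map (\<lambda>x. - f x) ys)"
    using xs by (auto simp: ys_def)
  then have len: "length ys = card X" using distinct_card by force
  have "bij_betw ((!) ys) {..<card X} X"
    using bij_betw_nth[OF ys(2)] ys(1) len by auto
  moreover have "f (ys ! k) \<le> f (ys ! i)" if "i \<le> k" "k < card X" for i k
    using sorted_nth_mono[OF ys(3), of i k] that len by simp
  ultimately show ?thesis using that by blast
qed

lemma average_mem_unit_interval:
  assumes "finite S" "\<And>x. x \<in> S \<Longrightarrow> f x \<in> {0..1::real}"
  shows "average S f \<in> {0..1}"
proof (cases "S = {}")
  case False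
  have "sum f S \<le> (\<Sum>x\<in>S. 1)" using assms by (intro sum_mono) auto
  moreover have "sum f S \<ge> 0" using assms by (intro sum_nonneg) auto
  ultimately show ?thesis using False assms by (simp add: average_def field_simps card_gt_0_iff)
qed (simp add: average_def)

text \<open>The bound \<open>D\<close> is kept independent of \<open>m\<close>, so that the property
  can be composed over coprime moduli.\<close>

definition density_transfer :: "'j set \<Rightarrow> real \<Rightarrow> int \<Rightarrow> bool" where
  "density_transfer J D m \<longleftrightarrow> (\<forall>f :: 'j \<Rightarrow> int \<Rightarrow> real.
     (\<forall>j\<in>J. \<forall>x\<in>unit_square_residues m. f j x \<in> {0..1}) \<longrightarrow>
     D < (\<Sum>j\<in>J. average (unit_square_residues m) (f j)) \<longrightarrow>
     (\<forall>j\<in>J. average (unit_square_residues m) (f j) \<noteq> 0) \<longrightarrow>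
     (\<forall>y. \<exists>x. (\<forall>j\<in>J. x j \<in> unit_square_residues m \<and> f j (x j) \<noteq> 0) \<and>
       [(\<Sum>j\<in>J. x j) = y] (mod m) \<and> D < (\<Sum>j\<in>J. f j (x j))))"

lemma density_transfer_1: "density_transfer J D 1"
proof -
  have "unit_square_residues 1 = {0}" by (auto simp: unit_square_residues_def)
  then show ?thesis
    unfolding density_transfer_def by (auto simp: average_def intro!: exI[of _ "\<lambda>_. 0"])
qed

lemma density_transfer_prime:
  fixes p :: int
  assumes J: "finite J" "card J = s" "s \<ge> 5" and p: "prime p" "p \<ge> 7" "s = 5 \<Longrightarrow> p \<ge> 11"
  shows "density_transfer J (real s * threshold s) p"
  unfolding density_transfer_def
proof (intro allI impI)
  fix f :: "'a \<Rightarrow> int \<Rightarrow> real" and y :: int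
  define Q where "Q = unit_square_residues p"
  define n where "n = card Q"
  assume range: "\<forall>j\<in>J. \<forall>x\<in>unit_square_residues p. f j x \<in> {0..1}"
    and T: "real s * threshold s < (\<Sum>j\<in>J. average (unit_square_residues p) (f j))"
    and nz: "\<forall>j\<in>J. average (unit_square_residues p) (f j) \<noteq> 0"
  have p_le: "p - 1 \<le> 2 * int n" unfolding n_def Q_def using p by (intro card_unit_square_residues) auto
  have finQ: "finite Q" by (simp add: Q_def)
  have "\<exists>e. bij_betw e {..<n} Q \<and> (\<forall>i k. i \<le> k \<longrightarrow> k < n \<longrightarrow> f j (e k) \<le> f j (e i))" for j
    using obtain_decreasing_enumeration[OF finQ, of "f j"] unfolding n_def by metis
  then obtain e where e: "\<And>j. bij_betw (e j) {..<n} Q"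
    "\<And>j i k. i \<le> k \<Longrightarrow> k < n \<Longrightarrow> f j (e j k) \<le> f j (e j i)" by metis
  have eQ: "e j k \<in> Q" if "k < n" for j k using bij_betw_apply[OF e(1)] that by simp
  define a where "a j k = f j (e j k)" for j k
  have "n > 0" using p_le p by linarith
  have a_range: "a j k \<in> {0..1}" if "j \<in> J" "k < n" for j k
    using range eQ that by (auto simp: a_def Q_def)
  interpret decreasing_families J a n
  proof
    fix j assume j: "j \<in> J"
    show "a j 0 > 0"
    proof (rule ccontr)
      assume "\<not> a j 0 > 0"
      have "f j x = 0" if "x \<in> Q" for x
      proof -
        have "x \<in> e j ` {..<n}" using that e(1)[of j] by (simp add: bij_betw_def)
        then obtain k where k: "k < n" "x = e j k" by auto
        have "a j k \<le> a j 0" unfolding a_def using k by (intro e) auto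
        then show ?thesis using a_range[OF j k(1)] \<open>\<not> a j 0 > 0\<close> k by (simp add: a_def)
      qed
      then have "average Q (f j) = 0" by (simp add: average_def)
      then show False using nz j by (simp add: Q_def)
    qed
  qed (use J a_range \<open>n > 0\<close> e(2) in \<open>auto simp: a_def\<close>)
  have "mean j = average Q (f j)" for j
    unfolding mean_def average_def a_def n_def[symmetric]
    using sum.reindex_bij_betw[OF e(1), of "f j" j] by simp
  then have T': "sum mean J > real s * threshold s" using T by (simp add: Q_def)
  \<comment> \<open>Here the excluded primes enter: \<open>p \<ge> 7\<close> gives at least three
    squares and \<open>p \<ge> 11\<close> at least five.\<close>
  have n: "n \<ge> 3" "s = 5 \<Longrightarrow> n \<ge> 5" using p_le p by linarith+
  obtain k where k: "\<And>j. j \<in> J \<Longrightarrow> k j < n" "\<And>j. j \<in> J \<Longrightarrow> a j (k j) > 0" "2 * n \<le> sum k J"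
    "(\<Sum>j\<in>J. a j (k j)) > real s * threshold s"
    using choice_above_threshold[OF J(2,3) n T'] by blast
  \<comment> \<open>On these top \<open>k j + 1\<close> squares \<open>f j\<close> is at least
    \<open>a j (k j)\<close>, so whichever elements represent \<open>y\<close>, their values stay
    above the threshold. The sizes minus 1 add up to at least \<open>2 * n \<ge> p - 1\<close>, as
    Cauchy-Davenport requires.\<close>
  define A where "A j = e j ` {..k j}" for j
  have cardA: "card (A j) = Suc (k j)" if "j \<in> J" for j
  proof -
    have "{..k j} \<subseteq> {..<n}" using k(1)[OF that] by auto
    then have "inj_on (e j) {..k j}" using e(1)[of j] inj_on_subset unfolding bij_betw_def by blast
    then show ?thesis by (simp add: A_def card_image)
  qed
  have AQ: "A j \<subseteq> Q" if "j \<in> J" for j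
    using eQ k(1)[OF that] by (auto simp: A_def)
  obtain x where x: "\<And>j. j \<in> J \<Longrightarrow> x j \<in> A j" "(\<Sum>j\<in>J. x j) mod p = y mod p"
  proof (rule cauchy_davenport_family[OF p(1) J(1), of A y])
    show "A j \<subseteq> {0..<p}" if "j \<in> J" for j
      using AQ[OF that] unit_square_residues_subset unfolding Q_def by blast
    show "A j \<noteq> {}" for j by (auto simp: A_def)
    have "(\<Sum>j\<in>J. card (A j) - 1) = sum k J" by (intro sum.cong) (auto simp: cardA)
    then show "nat p \<le> 1 + (\<Sum>j\<in>J. card (A j) - 1)" using k(3) p_le by linarith
  qed blast
  have ge: "f j (x j) \<ge> a j (k j)" if "j \<in> J" for j
    using x(1)[OF that] k(1)[OF that] e(2) by (auto simp: A_def a_def)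
  show "\<exists>x. (\<forall>j\<in>J. x j \<in> unit_square_residues p \<and> f j (x j) \<noteq> 0) \<and>
      [(\<Sum>j\<in>J. x j) = y] (mod p) \<and> real s * threshold s < (\<Sum>j\<in>J. f j (x j))"
  proof (intro exI[of _ x] conjI ballI)
    fix j assume j: "j \<in> J"
    show "x j \<in> unit_square_residues p" using x(1)[OF j] AQ[OF j] by (auto simp: Q_def)
    show "f j (x j) \<noteq> 0" using ge[OF j] k(2)[OF j] by simp
  next
    show "[(\<Sum>j\<in>J. x j) = y] (mod p)" using x(2) by (simp add: cong_def)
    show "real s * threshold s < (\<Sum>j\<in>J. f j (x j))"
      using k(4) sum_mono[OF ge] by (rule less_le_trans)
  qed
qed

section \<open>Chinese remainder theorem and averages over fibres\<close>

lemma unit_square_residues_crt: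
  fixes p m :: int
  assumes "coprime p m" "p > 0" "m > 0"
  shows "bij_betw (\<lambda>x. (x mod p, x mod m)) (unit_square_residues (p * m))
    (unit_square_residues p \<times> unit_square_residues m)"
  unfolding bij_betw_def
proof
  show "inj_on (\<lambda>x. (x mod p, x mod m)) (unit_square_residues (p * m))"
  proof (rule inj_onI)
    fix x y assume xy: "x \<in> unit_square_residues (p * m)" "y \<in> unit_square_residues (p * m)"
      "(x mod p, x mod m) = (y mod p, y mod m)"
    then have "[x = y] (mod p * m)"
      using assms by (intro coprime_cong_mult) (auto simp: cong_def)
    then show "x = y"
      using xy by (auto simp: unit_square_residues_def intro: cong_less_imp_eq_int)
  qed
  show "(\<lambda>x. (x mod p, x mod m)) ` unit_square_residues (p * m) = unit_square_residues p \<times> unit_square_residues m"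
  proof (intro equalityI subsetI)
    fix z assume "z \<in> (\<lambda>x. (x mod p, x mod m)) ` unit_square_residues (p * m)"
    then obtain x y where x: "z = (x mod p, x mod m)" and y: "coprime y (p * m)" "[x = y\<^sup>2] (mod p * m)"
      by (auto simp: unit_square_residues_def)
    have "[x = y\<^sup>2] (mod p)" "[x = y\<^sup>2] (mod m)"
      by (rule cong_dvd_modulus[OF y(2)], simp)+
    then show "z \<in> unit_square_residues p \<times> unit_square_residues m"
      using mod_mem_unit_square_residues[of p y x] mod_mem_unit_square_residues[of m y x] x y(1) assms
      by simp
  next
    fix z assume "z \<in> unit_square_residues p \<times> unit_square_residues m"
    then obtain u v c d where z: "z = (u, v)" and u: "u \<in> {0..<p}" "coprime c p" "[u = c\<^sup>2] (mod p)"
      and v: "v \<in> {0..<m}" "coprime d m" "[v = d\<^sup>2] (mod m)"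
      by (auto simp: unit_square_residues_def)
    \<comment> \<open>The square roots are combined rather than the squares, so that the result is
      visibly the square of a unit.\<close>
    obtain y where y: "[y = c] (mod p)" "[y = d] (mod m)"
      using binary_chinese_remainder_int[OF assms(1)] by blast
    have cop: "coprime y (p * m)"
      using y u v cong_imp_coprime cong_sym by (metis coprime_mult_right_iff)
    have "y\<^sup>2 mod (p * m) \<in> unit_square_residues (p * m)"
      using assms cop by (intro mod_mem_unit_square_residues) auto
    moreover have "y\<^sup>2 mod (p * m) mod p = u"
    proof -
      have "[y\<^sup>2 = u] (mod p)" using cong_trans[OF cong_pow[OF y(1)] cong_sym[OF u(3)]] .
      then show ?thesis using u by (simp add: cong_def mod_mod_cancel)
    qed
    moreover have "y\<^sup>2 mod (p * m) mod m = v"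
    proof -
      have "[y\<^sup>2 = v] (mod m)" using cong_trans[OF cong_pow[OF y(2)] cong_sym[OF v(3)]] .
      then show ?thesis using v by (simp add: cong_def mod_mod_cancel)
    qed
    ultimately show "z \<in> (\<lambda>x. (x mod p, x mod m)) ` unit_square_residues (p * m)"
      unfolding z by (metis (no_types, lifting) image_eqI)
  qed
qed

lemma average_product:
  assumes "bij_betw c (S \<times> T) U" "finite S" "finite T"
  shows "average U f = average S (\<lambda>u. average T (\<lambda>v. f (c (u, v))))"
proof -
  have "sum f U = (\<Sum>u\<in>S. \<Sum>v\<in>T. f (c (u, v)))"
    using sum.reindex_bij_betw[OF assms(1), of f] by (simp add: sum.cartesian_product)
  moreover have "card U = card S * card T"
    using bij_betw_same_card[OF assms(1)] by (simp add: card_cartesian_product)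
  ultimately show ?thesis by (simp add: average_def sum_divide_distrib[symmetric] mult.commute)
qed

text \<open>The property modulo \<open>p\<close> is applied to the fibre averages \<open>F j\<close>
  and selects one fibre \<open>u j\<close> for each \<open>j\<close>. Its conclusion about
  \<open>F j (u j)\<close> is the hypothesis modulo \<open>m\<close> for the restrictions of
  \<open>f j\<close> to these fibres.\<close>

lemma density_transfer_mult:
  fixes p m :: int
  assumes cop: "coprime p m" "p > 0" "m > 0"
    and P: "density_transfer J D p" and M: "density_transfer J D m"
  shows "density_transfer J D (p * m)"
  unfolding density_transfer_def
proof (intro allI impI)
  fix f :: "'a \<Rightarrow> int \<Rightarrow> real" and y :: int
  let ?Q = unit_square_residues
  assume range: "\<forall>j\<in>J. \<forall>x\<in>?Q (p * m). f j x \<in> {0..1}"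
    and T: "D < (\<Sum>j\<in>J. average (?Q (p * m)) (f j))"
    and nz: "\<forall>j\<in>J. average (?Q (p * m)) (f j) \<noteq> 0"
  let ?g = "\<lambda>x. (x mod p, x mod m)"
  define c where "c = inv_into (?Q (p * m)) ?g"
  note bij = unit_square_residues_crt[OF cop]
  have c: "bij_betw c (?Q p \<times> ?Q m) (?Q (p * m))"
    unfolding c_def by (rule bij_betw_inv_into[OF bij])
  have cQ: "c (u, v) \<in> ?Q (p * m)" "c (u, v) mod p = u" "c (u, v) mod m = v" if "u \<in> ?Q p" "v \<in> ?Q m" for u v
    using bij_betw_apply[OF c] bij_betw_inv_into_right[OF bij, of "(u, v)"] that by (auto simp: c_def)
  define F where "F j u = average (?Q m) (\<lambda>v. f j (c (u, v)))" for j u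
  have avg: "average (?Q (p * m)) (f j) = average (?Q p) (F j)" for j
    unfolding F_def by (rule average_product[OF c]) auto
  have "\<forall>j\<in>J. \<forall>u\<in>?Q p. F j u \<in> {0..1}"
    unfolding F_def using range cQ by (intro ballI average_mem_unit_interval) auto
  then obtain u where u: "\<And>j. j \<in> J \<Longrightarrow> u j \<in> ?Q p" "\<And>j. j \<in> J \<Longrightarrow> F j (u j) \<noteq> 0"
    "[(\<Sum>j\<in>J. u j) = y] (mod p)" "D < (\<Sum>j\<in>J. F j (u j))"
    using P[unfolded density_transfer_def, rule_format, of F y] T nz unfolding avg by blast
  define f' where "f' j v = f j (c (u j, v))" for j v
  have "\<forall>j\<in>J. \<forall>v\<in>?Q m. f' j v \<in> {0..1}"
    unfolding f'_def using range cQ u by blast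
  moreover have "average (?Q m) (f' j) = F j (u j)" for j unfolding f'_def F_def ..
  ultimately have "\<exists>v. (\<forall>j\<in>J. v j \<in> ?Q m \<and> f' j (v j) \<noteq> 0) \<and>
      [(\<Sum>j\<in>J. v j) = y] (mod m) \<and> D < (\<Sum>j\<in>J. f' j (v j))"
    using M[unfolded density_transfer_def, rule_format, of f' y] u by auto
  then obtain v where v: "\<And>j. j \<in> J \<Longrightarrow> v j \<in> ?Q m" "\<And>j. j \<in> J \<Longrightarrow> f' j (v j) \<noteq> 0"
    "[(\<Sum>j\<in>J. v j) = y] (mod m)" "D < (\<Sum>j\<in>J. f' j (v j))"
    by blast
  have "[c (u j, v j) = u j] (mod p)" "[c (u j, v j) = v j] (mod m)" if "j \<in> J" for j
    using cQ(2,3)[OF u(1)[OF that] v(1)[OF that]] unfolding cong_def by (metis mod_mod_trivial)+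
  then have "[(\<Sum>j\<in>J. c (u j, v j)) = (\<Sum>j\<in>J. u j)] (mod p)"
    "[(\<Sum>j\<in>J. c (u j, v j)) = (\<Sum>j\<in>J. v j)] (mod m)"
    by (auto intro!: cong_sum)
  then have "[(\<Sum>j\<in>J. c (u j, v j)) = y] (mod p * m)"
    using cong_trans u(3) v(3) cop(1) by (blast intro: coprime_cong_mult)
  then show "\<exists>x. (\<forall>j\<in>J. x j \<in> ?Q (p * m) \<and> f j (x j) \<noteq> 0) \<and>
      [(\<Sum>j\<in>J. x j) = y] (mod p * m) \<and> D < (\<Sum>j\<in>J. f j (x j))"
    using u v cQ by (intro exI[of _ "\<lambda>j. c (u j, v j)"]) (auto simp: f'_def)
qed

text \<open>Prime factors are split off one at a time; squarefreeness makes each coprime to its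
  cofactor.\<close>

lemma density_transfer_squarefree:
  fixes m :: int
  assumes J: "finite J" "card J = s" "s \<ge> 5" and m: "m > 0" "squarefree m"
    and large: "\<And>p. prime p \<Longrightarrow> p dvd m \<Longrightarrow> p \<ge> 7 \<and> (s = 5 \<longrightarrow> p \<ge> 11)"
  shows "density_transfer J (real s * threshold s) m"
  using m large
proof (induction "nat m" arbitrary: m rule: less_induct)
  case less
  show ?case
  proof (cases "m = 1")
    case True
    then show ?thesis by (simp add: density_transfer_1)
  next
    case False
    then obtain p where p: "prime p" "p dvd m"
      using less.prems prime_divisor_exists[of m] by (auto simp: zdvd1_eq)
    then obtain k where k: "m = p * k" by auto
    have p1: "p > 1" using p prime_gt_1_int by blast
    then have k0: "k > 0" using less.prems(1) k by (simp add: zero_less_mult_iff)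
    have "\<not> p dvd k"
    proof
      assume "p dvd k"
      then have "p\<^sup>2 dvd m" by (simp add: k power2_eq_square)
      then show False using squarefreeD[OF less.prems(2)] p not_prime_unit by blast
    qed
    then have "coprime p k" using p prime_imp_coprime by blast
    moreover have "density_transfer J (real s * threshold s) k"
    proof (rule less.hyps)
      show "nat k < nat m" using k k0 p1 by simp
      show "squarefree k" using less.prems(2) k squarefree_mono[of k m] by simp
    qed (use k k0 less.prems(3) in auto)
    moreover have "density_transfer J (real s * threshold s) p"
      using less.prems(3)[OF p] p J by (intro density_transfer_prime) auto
    ultimately show ?thesis using k k0 p1 density_transfer_mult by fastforce
  qed
qed

section \<open>The quotient ring\<close>

text \<open>\<open>ZMod k\<close> is the canonical projection onto the quotient; the rules for sums,
  products and the unit element follow from this.\<close>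

lemma ZMod_ring_hom: "ZMod k \<in> ring_hom \<Z> (ZFact k)"
proof -
  have "ideal (Idl\<^bsub>\<Z>\<^esub> {k}) \<Z>" by (rule int.genideal_ideal) simp
  then show ?thesis
    using ideal.rcos_ring_hom unfolding ZFact_def ZMod_def[abs_def] by blast
qed

lemma ZMod_in_carrier: "ZMod k a \<in> carrier (ZFact k)"
  using ring_hom_closed[OF ZMod_ring_hom] by simp

lemma ZMod_add: "ZMod k a \<oplus>\<^bsub>ZFact k\<^esub> ZMod k b = ZMod k (a + b)"
  using ring_hom_add[OF ZMod_ring_hom, of a b k] by simp

lemma ZMod_mult: "ZMod k a \<otimes>\<^bsub>ZFact k\<^esub> ZMod k b = ZMod k (a * b)"
  using ring_hom_mult[OF ZMod_ring_hom, of a b k] by simp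

lemma ZMod_one: "\<one>\<^bsub>ZFact k\<^esub> = ZMod k 1"
  using ring_hom_one[OF ZMod_ring_hom, of k] by simp

lemma carrier_ZFact: "carrier (ZFact k) = range (ZMod k)"
  by (auto simp: ZFact_def FactRing_def A_RCOSETS_def' ZMod_def)

lemma ZMod_zero: "\<zero>\<^bsub>ZFact k\<^esub> = ZMod k 0"
proof -
  interpret cring "ZFact k" by (rule ZFact_is_cring)
  show ?thesis
    using ZMod_add[of k 0 0] ZMod_in_carrier[of k 0] by (simp add: add.l_cancel_one)
qed

lemma ZMod_in_Units_iff: "ZMod k a \<in> Units (ZFact k) \<longleftrightarrow> coprime a k"
proof -
  have "ZMod k a \<in> Units (ZFact k) \<longleftrightarrow> (\<exists>b. [a * b = 1] (mod k))"
    by (auto simp: Units_def carrier_ZFact ZMod_mult ZMod_one ZMod_eq_mod cong_def mult.commute[of _ a])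
  also have "\<dots> \<longleftrightarrow> coprime a k" by (simp add: coprime_iff_invertible_int)
  finally show ?thesis .
qed

lemma ZMod_finsum:
  assumes "finite J"
  shows "(\<Oplus>\<^bsub>ZFact k\<^esub>j\<in>J. ZMod k (x j)) = ZMod k (\<Sum>j\<in>J. x j)"
proof -
  interpret cring "ZFact k" by (rule ZFact_is_cring)
  show ?thesis
    using assms
  proof (induction J rule: finite_induct)
    case (insert i J)
    have "(\<lambda>j. ZMod k (x j)) \<in> J \<rightarrow> carrier (ZFact k)" using ZMod_in_carrier by auto
    with insert show ?case by (simp add: finsum_insert ZMod_in_carrier ZMod_add)
  qed (simp add: ZMod_zero)
qed

lemma bij_betw_ZMod_unit_squares:
  assumes "W > 0"
  shows "bij_betw (ZMod (int W)) (unit_square_residues (int W)) (unit_squares W)"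
  unfolding bij_betw_def
proof
  let ?\<phi> = "ZMod (int W)"
  interpret cring "ZFact (int W)" by (rule ZFact_is_cring)
  show "inj_on ?\<phi> (unit_square_residues (int W))"
    by (rule inj_onI) (auto simp: ZMod_eq_mod unit_square_residues_def)
  have sq: "?\<phi> y [^]\<^bsub>ZFact (int W)\<^esub> (2::nat) = ?\<phi> (y\<^sup>2)" for y
    using ZMod_in_carrier by (simp add: numeral_2_eq_2 nat_pow_def ZMod_one ZMod_mult)
  show "?\<phi> ` unit_square_residues (int W) = unit_squares W"
  proof (intro equalityI subsetI)
    fix z assume "z \<in> ?\<phi> ` unit_square_residues (int W)"
    then obtain x y where "z = ?\<phi> x" "coprime y (int W)" "[x = y\<^sup>2] (mod int W)"
      by (auto simp: unit_square_residues_def)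
    then have "z \<in> carrier (ZFact (int W))" "?\<phi> y \<in> Units (ZFact (int W))"
      "z = ?\<phi> y [^]\<^bsub>ZFact (int W)\<^esub> (2::nat)"
      using ZMod_in_carrier ZMod_in_Units_iff unfolding sq by (auto simp only: ZMod_eq_mod cong_def)
    then show "z \<in> unit_squares W" unfolding unit_squares_def by blast
  next
    fix z assume "z \<in> unit_squares W"
    then obtain y where y: "y \<in> Units (ZFact (int W))" "z = y [^]\<^bsub>ZFact (int W)\<^esub> (2::nat)"
      by (auto simp: unit_squares_def)
    then obtain c where "y = ?\<phi> c" using carrier_ZFact Units_closed by blast
    then have "coprime c (int W)" "z = ?\<phi> (c\<^sup>2)" using y sq ZMod_in_Units_iff by auto
    then have "z = ?\<phi> (c\<^sup>2 mod int W)" "c\<^sup>2 mod int W \<in> unit_square_residues (int W)"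
      using ZMod_mod assms by (auto intro: mod_mem_unit_square_residues)
    then show "z \<in> ?\<phi> ` unit_square_residues (int W)" by blast
  qed
qed

section \<open>Passage from cosets to residues and back\<close>

theorem theorem1p4:
  fixes s W :: nat and f :: "nat \<Rightarrow> int set \<Rightarrow> real"
  assumes "s \<ge> 5"
    and "W > 0" and "squarefree W"
    and "s \<ge> 6 \<Longrightarrow> coprime (2 * 3 * 5) W"
    and "s = 5 \<Longrightarrow> coprime (2 * 3 * 5 * 7) W"
    and "\<And>j x. j \<in> {1..s} \<Longrightarrow> x \<in> unit_squares W \<Longrightarrow> f j x \<in> {0..1}"
    and "1 / real s * (\<Sum>j=1..s. average (unit_squares W) (f j)) > threshold s"
    and "\<And>j. j \<in> {1..s} \<Longrightarrow> average (unit_squares W) (f j) \<noteq> 0"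
  shows "\<forall>y \<in> carrier (ZFact (int W)).
    \<exists>x :: nat \<Rightarrow> int set.
      (\<forall>j\<in>{1..s}. x j \<in> unit_squares W) \<and>
      y = (\<Oplus>\<^bsub>ZFact (int W)\<^esub>j\<in>{1..s}. x j) \<and>
      1 / real s * (\<Sum>j=1..s. f j (x j)) > threshold s \<and>
      (\<forall>j\<in>{1..s}. f j (x j) \<noteq> 0)"
proof
  fix z assume "z \<in> carrier (ZFact (int W))"
  let ?\<phi> = "ZMod (int W)"
  let ?Q = "unit_square_residues (int W)"
  obtain y where y: "z = ?\<phi> y" using \<open>z \<in> _\<close> carrier_ZFact by blast
  have bij: "bij_betw ?\<phi> ?Q (unit_squares W)" by (rule bij_betw_ZMod_unit_squares[OF assms(2)])
  have avg: "average (unit_squares W) (f j) = average ?Q (\<lambda>x. f j (?\<phi> x))" for j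
    using sum.reindex_bij_betw[OF bij, of "f j"] bij_betw_same_card[OF bij] by (simp add: average_def)
  have above: "1 / real s * t > threshold s \<longleftrightarrow> t > real s * threshold s" for t
    using assms(1) by (simp add: field_simps)
  have "s = 5 \<or> s \<ge> 6" using assms(1) by linarith
  then have cop: "coprime 2 W" "coprime 3 W" "coprime 5 W" "s = 5 \<Longrightarrow> coprime 7 W"
    using assms(4,5) unfolding coprime_mult_left_iff by blast+
  have "density_transfer {1..s} (real s * threshold s) (int W)"
  proof (rule density_transfer_squarefree)
    fix p :: int assume p: "prime p" "p dvd int W"
    have nd: "\<not> int q dvd p" if "coprime q W" "q > 1" for q
    proof
      assume "int q dvd p"
      then have "q dvd W" using p(2) int_dvd_int_iff dvd_trans by blast
      then show False using that by (metis coprime_absorb_left nat_neq_iff nat_dvd_1_iff_1)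
    qed
    \<comment> \<open>Each integer from 2 to 6 is divisible by 2, 3 or 5, and each from 7 to 10 by
      2, 3, 5 or 7; excluding these divisors gives the lower bounds on \<open>p\<close>.\<close>
    have "\<not> 2 dvd p" "\<not> 3 dvd p" "\<not> 5 dvd p" using nd[OF cop(1)] nd[OF cop(2)] nd[OF cop(3)] by auto
    moreover have "s = 5 \<longrightarrow> \<not> 7 dvd p" using nd[OF cop(4)] by auto
    moreover have "p > 1" using prime_gt_1_int[OF p(1)] .
    ultimately show "p \<ge> 7 \<and> (s = 5 \<longrightarrow> p \<ge> 11)" by presburger
  next
    show "squarefree (int W)"
    proof (rule squarefreeI)
      fix x :: int assume "x\<^sup>2 dvd int W"
      then have "int ((nat \<bar>x\<bar>)\<^sup>2) dvd int W" by simp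
      then have "(nat \<bar>x\<bar>)\<^sup>2 dvd W" by (simp only: int_dvd_int_iff)
      then have "nat \<bar>x\<bar> dvd 1" using squarefreeD[OF assms(3)] by blast
      then show "x dvd 1" by simp
    qed
  qed (use assms(1,2) in auto)
  note transfer = this[unfolded density_transfer_def, rule_format, of "\<lambda>j x. f j (?\<phi> x)" y]
  have "\<exists>x. (\<forall>j\<in>{1..s}. x j \<in> ?Q \<and> f j (?\<phi> (x j)) \<noteq> 0) \<and>
      [(\<Sum>j=1..s. x j) = y] (mod int W) \<and> real s * threshold s < (\<Sum>j=1..s. f j (?\<phi> (x j)))"
  proof (rule transfer)
    show "f j (?\<phi> x) \<in> {0..1}" if "j \<in> {1..s}" "x \<in> ?Q" for j x
      using assms(6) that bij_betw_apply[OF bij] by blast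
    show "real s * threshold s < (\<Sum>j=1..s. average ?Q (\<lambda>x. f j (?\<phi> x)))"
      using assms(7) unfolding above avg .
    show "average ?Q (\<lambda>x. f j (?\<phi> x)) \<noteq> 0" if "j \<in> {1..s}" for j
      using assms(8)[OF that] unfolding avg .
  qed
  then obtain x where x: "\<forall>j\<in>{1..s}. x j \<in> ?Q \<and> f j (?\<phi> (x j)) \<noteq> 0"
      "[(\<Sum>j=1..s. x j) = y] (mod int W)" "real s * threshold s < (\<Sum>j=1..s. f j (?\<phi> (x j)))"
    by blast
  have "z = (\<Oplus>\<^bsub>ZFact (int W)\<^esub>j\<in>{1..s}. ?\<phi> (x j))"
    using x(2) by (simp add: y ZMod_finsum ZMod_eq_mod cong_def)
  moreover have "1 / real s * (\<Sum>j=1..s. f j (?\<phi> (x j))) > threshold s"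
    unfolding above by (rule x(3))
  ultimately show "\<exists>x :: nat \<Rightarrow> int set.
      (\<forall>j\<in>{1..s}. x j \<in> unit_squares W) \<and>
      z = (\<Oplus>\<^bsub>ZFact (int W)\<^esub>j\<in>{1..s}. x j) \<and>
      1 / real s * (\<Sum>j=1..s. f j (x j)) > threshold s \<and>
      (\<forall>j\<in>{1..s}. f j (x j) \<noteq> 0)"
    using x(1) bij_betw_apply[OF bij] by (intro exI[of _ "\<lambda>j. ?\<phi> (x j)"]) simp
qed

end
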